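(* Let $p,k,n$ be integers with $p\ge 4$, $0\le k\le p-1$, $n\ge p+1$, and $n\equiv k\pmod{p}$. Then $$\mathrm{sat}(n, K_1\vee(K_{p-1}\cup K_1))=\frac{(p-1)n}{2}+\frac{k(k-p)}{2}.$$ Furthermore, $\mathrm{SAT}(n, K_1\vee(K_{p-1}\cup K_1))=\{\lfloor\frac{n}{p}\rfloor K_p\cup K_k\}$; that is, up to isomorphism the unique extremal graph is the disjoint union of $\lfloor n/p\rfloor$ copies of $K_p$ and one copy of $K_k$.
   Context: All graphs are finite and simple. For graphs $F$ and $G$, $G$ is $F$-saturated if $G$ contains no copy of $F$ as a (not necessarily induced) subgraph, but for every edge $e$ of the complement $\overline{G}$, the graph $G+e$ obtained by adding $e$ to $G$ contains a copy of $F$. The saturation number $\mathrm{sat}(n,F)$ is the minimum number of edges in an $F$-saturated graph on $n$ vertices, and $\mathrm{SAT}(n,F)$ is the set (up to isomorphism) of $F$-saturated graphs on $n$ vertices with exactly $\mathrm{sat}(n,F)$ edges. $K_m$ is the complete graph on $m$ vertices ($K_0$ is the graph with no vertices), $\cup$ denotes vertex-disjoint union, $mG$ denotes the disjoint union of $m$ copies of $G$, and $G_1\vee G_2$ is the join, obtained from the disjoint union $G_1\cup G_2$ by adding all edges between $V(G_1)$ and $V(G_2)$. *)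

theory Defs
  imports Complex_Main "HOL-Number_Theory.Cong"
begin

datatype 'a graph = Graph (verts: "'a set") (edges: "'a set set")

definition pairs :: "'a set \<Rightarrow> 'a set set" where
  "pairs V = {e. e \<subseteq> V \<and> card e = 2}"

definition simple_graph :: "'a graph \<Rightarrow> bool" where
  "simple_graph G \<longleftrightarrow> finite (verts G) \<and> edges G \<subseteq> pairs (verts G)"

definition graph_iso :: "'a graph \<Rightarrow> 'b graph \<Rightarrow> bool" where
  "graph_iso G H \<longleftrightarrow> (\<exists>f. bij_betw f (verts G) (verts H) \<and> edges H = (`) f ` edges G)"

definition subgraph :: "'a graph \<Rightarrow> 'a graph \<Rightarrow> bool" where
  "subgraph H G \<longleftrightarrow> simple_graph H \<and> verts H \<subseteq> verts G \<and> edges H \<subseteq> edges G"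

definition contains_copy :: "'a graph \<Rightarrow> 'b graph \<Rightarrow> bool" where
  "contains_copy G F \<longleftrightarrow> (\<exists>H. subgraph H G \<and> graph_iso F H)"

definition complement :: "'a graph \<Rightarrow> 'a graph" where
  "complement G = Graph (verts G) (pairs (verts G) - edges G)"

definition add_edge :: "'a graph \<Rightarrow> 'a set \<Rightarrow> 'a graph" where
  "add_edge G e = Graph (verts G) (insert e (edges G))"

definition saturated :: "'b graph \<Rightarrow> 'a graph \<Rightarrow> bool" where
  "saturated F G \<longleftrightarrow> simple_graph G \<and> \<not> contains_copy G F \<and>
     (\<forall>e \<in> edges (complement G). contains_copy (add_edge G e) F)"

text \<open>Every finite graph is isomorphic to one whose vertices are natural numbers, so the
  minimum and the extremal graphs may be taken over graphs with vertices in \<^typ>\<open>nat\<close>.\<close>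

definition saturated_graphs :: "nat \<Rightarrow> 'b graph \<Rightarrow> nat graph set" where
  "saturated_graphs n F = {G. saturated F G \<and> card (verts G) = n}"

definition sat :: "nat \<Rightarrow> 'b graph \<Rightarrow> nat" where
  "sat n F = (LEAST m. \<exists>G \<in> saturated_graphs n F. card (edges G) = m)"

text \<open>Graphs up to isomorphism: \<open>SAT\<close> is a set of isomorphism classes. The representative \<open>G\<close>
  of a class may have vertices of any type, the members of the class are graphs on naturals.\<close>

definition iso_class :: "'a graph \<Rightarrow> nat graph set" where
  "iso_class G = {H. simple_graph H \<and> graph_iso G H}"

definition SAT :: "nat \<Rightarrow> 'b graph \<Rightarrow> nat graph set set" where
  "SAT n F = iso_class ` {G \<in> saturated_graphs n F. card (edges G) = sat n F}"

definition complete_graph :: "nat \<Rightarrow> nat graph" where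
  "complete_graph m = Graph {..<m} (pairs {..<m})"

definition disj_union :: "'a graph \<Rightarrow> 'b graph \<Rightarrow> ('a + 'b) graph" where
  "disj_union G H = Graph (verts G <+> verts H) ((`) Inl ` edges G \<union> (`) Inr ` edges H)"

definition copies :: "nat \<Rightarrow> 'a graph \<Rightarrow> (nat \<times> 'a) graph" where
  "copies m G = Graph ({..<m} \<times> verts G) (\<Union>i<m. (`) (Pair i) ` edges G)"

definition join :: "'a graph \<Rightarrow> 'b graph \<Rightarrow> ('a + 'b) graph" where
  "join G H = Graph (verts G <+> verts H)
     (edges (disj_union G H) \<union> {{Inl u, Inr v} |u v. u \<in> verts G \<and> v \<in> verts H})"

lemma simple_graph_complete_graph: "simple_graph (complete_graph m)"
  by (simp add: simple_graph_def complete_graph_def)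

lemma simple_graph_disj_union:
  assumes "simple_graph G" "simple_graph H"
  shows "simple_graph (disj_union G H)"
  using assms unfolding simple_graph_def disj_union_def pairs_def
  by (auto simp: card_image)

lemma simple_graph_copies:
  assumes "simple_graph G"
  shows "simple_graph (copies m G)"
  using assms unfolding simple_graph_def copies_def pairs_def
  by (auto simp: card_image inj_on_def)

lemma simple_graph_join:
  assumes "simple_graph G" "simple_graph H"
  shows "simple_graph (join G H)"
  using simple_graph_disj_union[OF assms]
  unfolding simple_graph_def join_def disj_union_def pairs_def
  by auto

end

(* The forbidden graph is K_p with a pendant edge, so in a saturated graph every K_p is a connected
   component. Let B be the set of vertices in no K_p. If B is complete, then |B| < p and the graph is
   the claimed one. Otherwise adding a missing edge of B creates a K_p inside B that still has a
   pendant edge, hence |B| >= p + 1 and any two nonadjacent vertices of B have a clique of p - 2 common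
   neighbours. If some v in B has degree p - 2, then N(v) is a clique joined to all of B, which gives
   many edges. If all degrees are at least p - 1, the degree sum suffices unless p divides |B| and
   B is (p-1)-regular; this is impossible, because the at least p nonneighbours of v would send at
   least p(p-2) edges into N(v), which has room for (p-1)(p-2). *)

theory Submission
  imports Defs
begin

section \<open>Unordered pairs and the degree sum\<close>

lemma doubleton_in_pairs: "{x, y} \<in> pairs V \<longleftrightarrow> x \<noteq> y \<and> x \<in> V \<and> y \<in> V"
  by (auto simp: pairs_def card_insert_if)

lemma in_pairsE:
  assumes "e \<in> pairs V"
  obtains x y where "e = {x, y}" "x \<noteq> y" "x \<in> V" "y \<in> V"
  using assms by (auto simp: pairs_def card_2_iff)

lemma pairs_subset_iff: "pairs T \<subseteq> E \<longleftrightarrow> (\<forall>x\<in>T. \<forall>y\<in>T. x \<noteq> y \<longrightarrow> {x, y} \<in> E)"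
proof (intro iffI subsetI ballI impI)
  fix e assume "\<forall>x\<in>T. \<forall>y\<in>T. x \<noteq> y \<longrightarrow> {x, y} \<in> E" "e \<in> pairs T"
  then show "e \<in> E" by (auto elim!: in_pairsE)
qed (auto simp: doubleton_in_pairs)

lemma pairs_mono: "S \<subseteq> T \<Longrightarrow> pairs S \<subseteq> pairs T"
  by (auto simp: pairs_def)

lemma finite_pairs: "finite V \<Longrightarrow> finite (pairs V)"
  by (rule finite_subset[of _ "Pow V"]) (auto simp: pairs_def)

lemma card_pairs: "finite V \<Longrightarrow> card (pairs V) = card V choose 2"
  unfolding pairs_def by (rule n_subsets)

lemma pairs_disjoint: "S \<inter> T = {} \<Longrightarrow> pairs S \<inter> pairs T = {}"
proof -
  assume "S \<inter> T = {}"
  moreover have "pairs S \<inter> pairs T = pairs (S \<inter> T)" by (auto simp: pairs_def)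
  moreover have "pairs {} = {}" by (simp add: pairs_def)
  ultimately show ?thesis by simp
qed

lemma pairs_insert: "a \<notin> S \<Longrightarrow> pairs (insert a S) = pairs S \<union> (\<lambda>x. {a, x}) ` S"
proof (intro equalityI subsetI)
  fix e assume "e \<in> pairs (insert a S)"
  then obtain x y where "e = {x, y}" "x \<noteq> y" "x \<in> insert a S" "y \<in> insert a S" by (rule in_pairsE)
  then show "e \<in> pairs S \<union> (\<lambda>x. {a, x}) ` S"
    by (cases "x = a"; cases "y = a") (auto simp: doubleton_in_pairs doubleton_eq_iff)
qed (auto simp: doubleton_in_pairs elim!: in_pairsE)

lemma pairs_image: "inj_on f S \<Longrightarrow> pairs (f ` S) = (`) f ` pairs S"
proof (intro equalityI subsetI)
  fix e assume inj: "inj_on f S" and "e \<in> pairs (f ` S)"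
  then obtain x y where "e = f ` {x, y}" "f x \<noteq> f y" "x \<in> S" "y \<in> S"
    by (force elim!: in_pairsE)
  then show "e \<in> (`) f ` pairs S" by (metis doubleton_in_pairs imageI)
next
  fix e assume "inj_on f S" "e \<in> (`) f ` pairs S"
  then show "e \<in> pairs (f ` S)"
    by (auto simp: doubleton_in_pairs inj_on_def elim!: in_pairsE)
qed

text \<open>Double counting of incidences: \<open>w\<close> and \<open>{v, w}\<close> determine each
  other for fixed \<open>v\<close>, so the neighbours of \<open>v\<close> are as many as the edges
  at \<open>v\<close>, and every edge is met by exactly two vertices.\<close>

lemma sum_degrees:
  assumes "finite V" "E \<subseteq> pairs V"
  shows "(\<Sum>v\<in>V. card {w. {v, w} \<in> E}) = 2 * card E"
proof -
  have "card {w. {v, w} \<in> E} = card {e \<in> E. v \<in> e}" for v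
  proof (rule bij_betw_same_card[of "\<lambda>w. {v, w}"])
    show "bij_betw (\<lambda>w. {v, w}) {w. {v, w} \<in> E} {e \<in> E. v \<in> e}"
      unfolding bij_betw_def
    proof (intro conjI equalityI subsetI)
      show "inj_on (\<lambda>w. {v, w}) {w. {v, w} \<in> E}"
        by (auto simp: inj_on_def doubleton_eq_iff)
      fix e assume "e \<in> {e \<in> E. v \<in> e}"
      moreover from this obtain x y where "e = {x, y}" using assms by (blast elim: in_pairsE)
      ultimately show "e \<in> (\<lambda>w. {v, w}) ` {w. {v, w} \<in> E}"
        by (auto simp: insert_commute image_iff)
    qed auto
  qed
  moreover have "(\<Sum>v\<in>V. card {e \<in> E. v \<in> e}) = 2 * card E"
  proof (rule sum_multicount)
    show "\<forall>e\<in>E. card {v \<in> V. v \<in> e} = 2"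
    proof
      fix e assume "e \<in> E"
      then have "e \<subseteq> V" "card e = 2" using assms by (auto simp: pairs_def)
      moreover from this have "{v \<in> V. v \<in> e} = e" by auto
      ultimately show "card {v \<in> V. v \<in> e} = 2" by simp
    qed
  qed (use assms finite_pairs finite_subset in auto)
  ultimately show ?thesis by simp
qed

subsection \<open>Cliques with a pendant edge\<close>

text \<open>The embedding-free form of containing the forbidden graph: any edge leaving a
  \<open>p\<close>-clique supplies the pendant vertex. All later arguments about saturation use this
  form.\<close>

definition pendant_clique :: "nat \<Rightarrow> 'a graph \<Rightarrow> bool" where
  "pendant_clique p G \<longleftrightarrow> (\<exists>T v w. T \<subseteq> verts G \<and> card T = p \<and> pairs T \<subseteq> edges G
     \<and> v \<in> T \<and> w \<notin> T \<and> {v, w} \<in> edges G)"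

lemma pendant_cliqueI:
  assumes "T \<subseteq> verts G" "card T = p" "pairs T \<subseteq> edges G" "v \<in> T" "w \<notin> T" "{v, w} \<in> edges G"
  shows "pendant_clique p G"
  using assms unfolding pendant_clique_def by blast

text \<open>An embedding carries \<open>S\<close> to a clique and \<open>{v, w}\<close> to an edge
  leaving it. Conversely, the vertices of a clique are interchangeable, so any clique of the right
  size with an edge leaving it can serve as the image.\<close>

lemma contains_copy_pendant_iff:
  assumes G: "simple_graph G" and S: "finite S" "v \<in> S" "w \<notin> S"
  shows "contains_copy G (Graph (insert w S) (insert {v, w} (pairs S))) \<longleftrightarrow> pendant_clique (card S) G"
proof
  assume "contains_copy G (Graph (insert w S) (insert {v, w} (pairs S)))"
  then obtain H f where H: "subgraph H G" and f: "bij_betw f (insert w S) (verts H)"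
    "edges H = (`) f ` insert {v, w} (pairs S)"
    by (auto simp: contains_copy_def graph_iso_def)
  have inj: "inj_on f (insert w S)" using f by (simp add: bij_betw_def)
  then have injS: "inj_on f S" by (rule inj_on_subset) auto
  have HG: "verts H \<subseteq> verts G" "edges H \<subseteq> edges G" using H by (auto simp: subgraph_def)
  show "pendant_clique (card S) G"
  proof (rule pendant_cliqueI)
    show "f ` S \<subseteq> verts G" using f HG by (auto simp: bij_betw_def)
    show "card (f ` S) = card S" by (rule card_image[OF injS])
    show "pairs (f ` S) \<subseteq> edges G" using f HG by (auto simp: pairs_image[OF injS])
    show "f v \<in> f ` S" using S by simp
    show "f w \<notin> f ` S" using S inj by (auto simp: inj_on_def)
    show "{f v, f w} \<in> edges G" using f HG by auto
  qed
next
  assume "pendant_clique (card S) G"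
  then obtain T x y where T: "T \<subseteq> verts G" "card T = card S" "pairs T \<subseteq> edges G" "x \<in> T" "y \<notin> T"
    "{x, y} \<in> edges G" unfolding pendant_clique_def by blast
  have finT: "finite T" using T(1) G finite_subset by (auto simp: simple_graph_def)
  then have "card (S - {v}) = card (T - {x})" using S T by simp
  \<comment> \<open>Only the images of \<open>v\<close> and \<open>w\<close> are prescribed; the
    rest of the clique may be matched arbitrarily.\<close>
  then obtain g where g: "bij_betw g (S - {v}) (T - {x})"
    using finite_same_card_bij[of "S - {v}" "T - {x}"] S finT by auto
  define f where "f = g(v := x, w := y)"
  have S': "S = insert v (S - {v})" using S by blast
  have fg: "f ` (S - {v}) = T - {x}"
    using g S by (auto simp: f_def bij_betw_def)
  have fv: "f v = x" using S by (auto simp: f_def)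
  have fS: "f ` S = T" using fg fv T by (subst S') auto
  have "inj_on f (S - {v})"
    using g S by (subst inj_on_cong[of _ _ g]) (auto simp: f_def bij_betw_def)
  then have "inj_on f (insert v (S - {v}))" unfolding inj_on_insert using fg fv by simp
  then have fT: "inj_on f S" using S' by metis
  have "bij_betw f (insert w S) (insert y T)"
    unfolding bij_betw_def using fS fT S T by (auto simp: inj_on_insert f_def)
  moreover have "insert {x, y} (pairs T) = (`) f ` insert {v, w} (pairs S)"
    using pairs_image[OF fT] fS S by (auto simp: f_def)
  moreover have "y \<in> verts G" using T G by (auto simp: simple_graph_def pairs_def)
  then have "subgraph (Graph (insert y T) (insert {x, y} (pairs T))) G"
    using T finT pairs_mono[of T "insert y T"]
    by (auto simp: subgraph_def simple_graph_def doubleton_in_pairs)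
  ultimately show "contains_copy G (Graph (insert w S) (insert {v, w} (pairs S)))"
    unfolding contains_copy_def graph_iso_def by (metis graph.sel)
qed

text \<open>The apex \<open>Inl 0\<close> and the \<open>K_m\<close> together form a clique on
  \<open>m + 1\<close> vertices. The vertex \<open>Inr (Inr 0)\<close> is adjacent to the apex alone
  and is therefore the pendant one.\<close>

lemma join_pendant_eq:
  "join (complete_graph 1) (disj_union (complete_graph m) (complete_graph 1)) =
    (let S = insert (Inl 0) (Inr ` Inl ` {..<m})
     in Graph (insert (Inr (Inr 0)) S) (insert {Inl 0, Inr (Inr 0)} (pairs S)))"
proof -
  let ?S = "insert (Inl 0) (Inr ` Inl ` {..<m}) :: (nat + nat + nat) set"
  have p1: "pairs {..<Suc 0} = {}" by (auto elim!: in_pairsE)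
  have "pairs ?S = pairs (Inr ` Inl ` {..<m}) \<union> (\<lambda>x. {Inl 0, x}) ` Inr ` Inl ` {..<m}"
    by (rule pairs_insert) auto
  also have "pairs (Inr ` Inl ` {..<m} :: (nat + nat + nat) set) = (`) Inr ` (`) Inl ` pairs {..<m}"
    by (simp add: pairs_image)
  finally have "pairs ?S = (`) Inr ` (`) Inl ` pairs {..<m} \<union> (\<lambda>x. {Inl 0, x}) ` Inr ` Inl ` {..<m}" .
  moreover have "{{Inl u, Inr v} | u v. u < Suc 0 \<and> v \<in> {..<m} <+> {..<Suc 0}}
    = insert {Inl 0, Inr (Inr 0)} ((\<lambda>x. {Inl 0, x}) ` Inr ` Inl ` {..<m} :: (nat + nat + nat) set set)"
    by (auto simp: less_Suc_eq image_iff)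
  moreover have "{..<Suc 0} <+> ({..<m} <+> {..<Suc 0}) = insert (Inr (Inr 0)) ?S"
    by auto
  ultimately show ?thesis
    by (simp add: join_def disj_union_def complete_graph_def p1 Let_def)
qed

text \<open>Adding a missing edge keeps the graph simple, so the criterion for pendant cliques
  applies to \<open>G\<close> and to each \<open>add_edge G e\<close>. With \<open>p \<ge> 1\<close>
  the truncated \<open>p - 1\<close> is exact, and the apex completes \<open>K_p\<close>.\<close>

lemma saturated_pendant_iff:
  fixes G :: "'a graph"
  assumes "p \<ge> 1"
  shows "saturated (join (complete_graph 1) (disj_union (complete_graph (p - 1)) (complete_graph 1))) G
    \<longleftrightarrow> simple_graph G \<and> \<not> pendant_clique p G \<and>
       (\<forall>e \<in> pairs (verts G) - edges G. pendant_clique p (add_edge G e))"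
proof -
  let ?S = "insert (Inl 0) (Inr ` Inl ` {..<p - 1}) :: (nat + nat + nat) set"
  have "card ?S = p" using assms by (simp add: card_insert_if image_iff card_image)
  then have *: "contains_copy H (join (complete_graph 1) (disj_union (complete_graph (p - 1)) (complete_graph 1)))
    \<longleftrightarrow> pendant_clique p H" if "simple_graph H" for H :: "'a graph"
    using contains_copy_pendant_iff[OF that, of ?S "Inl 0" "Inr (Inr 0)"]
    unfolding join_pendant_eq Let_def by auto
  have "simple_graph (add_edge G e)" if "simple_graph G" "e \<in> pairs (verts G)" for e
    using that by (auto simp: simple_graph_def add_edge_def)
  then show ?thesis using * by (auto simp: saturated_def complement_def)
qed

subsection \<open>Disjoint unions of cliques\<close>

text \<open>Built on given vertex sets instead of tagged sums, so that a saturated graph can be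
  shown equal, not merely isomorphic, to such a union.\<close>

definition clique_union :: "'a set set \<Rightarrow> 'a set \<Rightarrow> 'a graph" where
  "clique_union P B = Graph (\<Union>P \<union> B) ((\<Union>T\<in>P. pairs T) \<union> pairs B)"

text \<open>\<open>E\<close> may be any set of edges within \<open>B\<close>: the count serves both
  for the extremal graphs, where \<open>E = pairs B\<close>, and for a saturated graph whose part
  outside the \<open>p\<close>-cliques is not complete.\<close>

lemma card_edges_clique_union:
  assumes "finite P" "\<And>T. T \<in> P \<Longrightarrow> finite T \<and> card T = p" "pairwise disjnt P"
    "finite E" "E \<subseteq> pairs B" "\<Union>P \<inter> B = {}"
  shows "card ((\<Union>T\<in>P. pairs T) \<union> E) = card P * (p choose 2) + card E"
proof -
  have "card (\<Union>T\<in>P. pairs T) = (\<Sum>T\<in>P. card (pairs T))"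
    using assms by (intro card_UN_disjoint) (auto simp: finite_pairs pairwise_def disjnt_def pairs_disjoint)
  also have "\<dots> = card P * (p choose 2)" using assms by (simp add: card_pairs)
  finally have "card (\<Union>T\<in>P. pairs T) = card P * (p choose 2)" .
  moreover have "(\<Union>T\<in>P. pairs T) \<inter> E = {}"
  proof -
    have "pairs T \<inter> pairs B = {}" if "T \<in> P" for T using assms(6) that by (intro pairs_disjoint) auto
    then show ?thesis using assms(5) by blast
  qed
  ultimately show ?thesis using assms by (subst card_Un_disjoint) (auto simp: finite_pairs)
qed

text \<open>\<open>P\<close> collects the components \<open>K\<^sub>p\<close>, and \<open>B\<close> is the vertex set of the leftover \<open>K\<^sub>k\<close>, possibly empty.\<close>

definition clique_blocks :: "nat \<Rightarrow> 'a set set \<Rightarrow> 'a set \<Rightarrow> bool" where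
  "clique_blocks p P B \<longleftrightarrow> finite P \<and> (\<forall>T\<in>P. finite T \<and> card T = p) \<and> pairwise disjnt P
     \<and> finite B \<and> card B < p \<and> \<Union>P \<inter> B = {}"

lemma card_Union_blocks:
  assumes "finite P" "\<And>T. T \<in> P \<Longrightarrow> finite T \<and> card T = p" "pairwise disjnt P"
    "finite B" "\<Union>P \<inter> B = {}"
  shows "card (\<Union>P \<union> B) = card P * p + card B"
proof -
  have "card (\<Union>P) = card P * p"
    using assms by (subst card_Union_disjoint) auto
  then show ?thesis using assms by (subst card_Un_disjoint) auto
qed

text \<open>Blocks have at most \<open>p\<close> vertices and no edge joins two of them, which
  leaves no room for a \<open>p\<close>-clique with a pendant vertex. A missing edge joins two
  blocks, at least one of them a \<open>K_p\<close>, and becomes pendant there.\<close>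

lemma clique_union_saturated:
  assumes blocks: "clique_blocks p P B" and "P \<noteq> {}"
  shows "simple_graph (clique_union P B)" "\<not> pendant_clique p (clique_union P B)"
    "\<forall>e \<in> pairs (verts (clique_union P B)) - edges (clique_union P B).
       pendant_clique p (add_edge (clique_union P B) e)"
proof -
  have P: "finite P" "\<And>T. T \<in> P \<Longrightarrow> finite T \<and> card T = p" "pairwise disjnt P"
    and B: "finite B" "card B < p" "\<Union>P \<inter> B = {}"
    using blocks by (auto simp: clique_blocks_def)
  have edge_iff: "{x, y} \<in> edges (clique_union P B) \<longleftrightarrow> x \<noteq> y \<and> (\<exists>X \<in> insert B P. x \<in> X \<and> y \<in> X)" for x y
    by (auto simp: clique_union_def doubleton_in_pairs)
  have "pairs T \<subseteq> pairs (\<Union>P \<union> B)" if "T \<in> insert B P" for T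
    using that by (intro pairs_mono) auto
  then show "simple_graph (clique_union P B)"
    using P B by (auto simp: simple_graph_def clique_union_def)
  show "\<not> pendant_clique p (clique_union P B)"
  proof
    assume "pendant_clique p (clique_union P B)"
    then obtain T v w where T: "card T = p" "pairs T \<subseteq> edges (clique_union P B)" "v \<in> T" "w \<notin> T"
      "{v, w} \<in> edges (clique_union P B)" by (auto simp: pendant_clique_def)
    then obtain X where X: "X \<in> insert B P" "v \<in> X" "w \<in> X" by (auto simp: edge_iff)
    \<comment> \<open>\<open>X\<close> is the only block through \<open>v\<close>, so it contains
      all neighbours of \<open>v\<close>, in particular \<open>w\<close> and the rest of
      \<open>T\<close>: \<open>p + 1\<close> vertices in a block of at most
      \<open>p\<close>.\<close>
    have same: "Y = X" if "Y \<in> insert B P" "v \<in> Y" for Y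
      using that X P(3) B(3) by (auto simp: pairwise_def disjnt_def)
    have "y \<in> X" if "y \<in> T" for y
    proof (cases "y = v")
      case False
      then have "{v, y} \<in> edges (clique_union P B)" using T that by (auto simp: pairs_subset_iff)
      then show ?thesis using same by (auto simp: edge_iff)
    qed (use X in simp)
    then have "insert w T \<subseteq> X" using X by auto
    moreover have "finite X" "card X \<le> p" using X P B by auto
    moreover from calculation have "finite T" using finite_subset by auto
    ultimately have "card (insert w T) \<le> p" "finite T"
      using card_mono[of X "insert w T"] by auto
    then show False using T by simp
  qed
  show "\<forall>e \<in> pairs (verts (clique_union P B)) - edges (clique_union P B).
       pendant_clique p (add_edge (clique_union P B) e)"
  proof
    fix e assume e: "e \<in> pairs (verts (clique_union P B)) - edges (clique_union P B)"
    then have "e \<in> pairs (\<Union>P \<union> B)" by (simp add: clique_union_def)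
    then obtain x y where xy: "e = {x, y}" "x \<noteq> y" "x \<in> \<Union>P \<union> B" "y \<in> \<Union>P \<union> B"
      by (rule in_pairsE)
    have "\<not> (x \<in> B \<and> y \<in> B)" using e xy by (auto simp: edge_iff)
    then obtain u v T where uv: "e = {u, v}" "T \<in> P" "u \<in> T" "v \<in> \<Union>P \<union> B" "u \<noteq> v"
    proof (cases "x \<in> B")
      case True
      with \<open>\<not> (x \<in> B \<and> y \<in> B)\<close> obtain T where "T \<in> P" "y \<in> T" using xy by blast
      then show thesis using that[of y x T] xy by (simp add: insert_commute)
    next
      case False
      then obtain T where "T \<in> P" "x \<in> T" using xy by blast
      then show thesis using that[of x y T] xy by simp
    qed
    have "v \<notin> T" using e uv by (auto simp: edge_iff)
    then show "pendant_clique p (add_edge (clique_union P B) e)"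
      using uv P by (intro pendant_cliqueI[of T _ _ u v]) (auto simp: add_edge_def clique_union_def)
  qed
qed

lemma clique_union_iso:
  assumes "clique_blocks p P B"
  shows "graph_iso (disj_union (copies (card P) (complete_graph p)) (complete_graph (card B))) (clique_union P B)"
proof -
  have P: "finite P" "\<And>T. T \<in> P \<Longrightarrow> finite T \<and> card T = p" "pairwise disjnt P"
    and B: "finite B" "\<Union>P \<inter> B = {}"
    using assms by (auto simp: clique_blocks_def)
  obtain h where h: "bij_betw h {..<card P} P"
    using ex_bij_betw_nat_finite[OF P(1)] by (auto simp: lessThan_atLeast0)
  obtain b where b: "bij_betw b {..<card B} B"
    using ex_bij_betw_nat_finite[OF B(1)] by (auto simp: lessThan_atLeast0)
  have "\<exists>g. bij_betw g {..<p} T" if "T \<in> P" for T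
    using ex_bij_betw_nat_finite[of T] P(2)[OF that] by (auto simp: lessThan_atLeast0)
  then obtain g where g: "\<And>T. T \<in> P \<Longrightarrow> bij_betw (g T) {..<p} T" by metis
  \<comment> \<open>\<open>h\<close> numbers the \<open>p\<close>-cliques, \<open>g T\<close>
    numbers the vertices of \<open>T\<close>, and \<open>b\<close> those of \<open>B\<close>.
    Injectivity across blocks comes from their disjointness.\<close>
  define f where "f = case_sum (\<lambda>(i, j). g (h i) j) b"
  have hP: "h ` {..<card P} = P" "inj_on h {..<card P}" using h by (auto simp: bij_betw_def)
  have bB: "b ` {..<card B} = B" "inj_on b {..<card B}" using b by (auto simp: bij_betw_def)
  have gT: "g T ` {..<p} = T" "inj_on (g T) {..<p}" if "T \<in> P" for T
    using g[OF that] by (auto simp: bij_betw_def)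
  have "inj_on f (({..<card P} \<times> {..<p}) <+> {..<card B})"
  proof (rule inj_onI)
    fix x y assume x: "x \<in> ({..<card P} \<times> {..<p}) <+> {..<card B}"
      and y: "y \<in> ({..<card P} \<times> {..<p}) <+> {..<card B}" and eq: "f x = f y"
    have in_block: "h i \<in> P" "g (h i) j \<in> h i" if "i < card P" "j < p" for i j
      using hP gT that by blast+
    have in_B: "b j \<in> B" if "j < card B" for j using bB that by blast
    have "i = i' \<and> j = j'" if *: "i < card P" "j < p" "i' < card P" "j' < p" "g (h i) j = g (h i') j'" for i j i' j'
    proof -
      have "h i = h i'" using in_block[OF *(1,2)] in_block[OF *(3,4)] *(5) P(3)
        by (auto simp: pairwise_def disjnt_def)
      moreover from this have "i = i'" using hP(2) * by (auto simp: inj_on_def)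
      ultimately show ?thesis using gT(2)[OF in_block(1)[OF *(1,2)]] * by (auto simp: inj_on_def)
    qed
    moreover have "g (h i) j \<noteq> b l" if "i < card P" "j < p" "l < card B" for i j l
      using in_block[OF that(1,2)] in_B[OF that(3)] B(2) by auto
    ultimately show "x = y" using x y eq inj_onD[OF bB(2)] unfolding f_def
      by (elim PlusE SigmaE) (simp_all, metis)
  qed
  moreover have "f ` (({..<card P} \<times> {..<p}) <+> {..<card B}) = \<Union>P \<union> B"
  proof -
    have "f ` (({..<card P} \<times> {..<p}) <+> {..<card B}) = (\<Union>T\<in>h ` {..<card P}. g T ` {..<p}) \<union> b ` {..<card B}"
      by (auto simp: f_def image_iff split: sum.splits) blast+
    also have "\<dots> = \<Union>P \<union> B" using hP bB gT by simp
    finally show ?thesis .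
  qed
  moreover have "(`) f ` edges (disj_union (copies (card P) (complete_graph p)) (complete_graph (card B)))
      = edges (clique_union P B)"
  proof -
    have "(`) f ` edges (disj_union (copies (card P) (complete_graph p)) (complete_graph (card B)))
      = (\<Union>T\<in>h ` {..<card P}. (`) (g T) ` pairs {..<p}) \<union> (`) b ` pairs {..<card B}"
      by (simp add: disj_union_def copies_def complete_graph_def f_def image_Un image_UN image_image)
    also have "\<dots> = (\<Union>T\<in>P. pairs T) \<union> pairs B"
      using hP bB gT by (simp flip: pairs_image)
    finally show ?thesis by (simp add: clique_union_def)
  qed
  ultimately show ?thesis
    unfolding graph_iso_def bij_betw_def
    by (intro exI[of _ f]) (simp add: disj_union_def copies_def complete_graph_def clique_union_def)
qed

subsection \<open>The edges outside the cliques\<close>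

text \<open>The right side bounds from below a degree sum on \<open>m\<close> vertices in which
  \<open>p - 2\<close> vertices have degree \<open>m - 1\<close> and the others degree at least
  \<open>p - 2\<close>. The left side is twice the claimed number of edges on \<open>m\<close>
  vertices.\<close>

lemma degree_sum_arith:
  fixes p m :: int
  assumes p: "p \<ge> 4" and m: "m \<ge> p + 1" and k: "k = m mod p"
  shows "(p - 1) * m + k * (k - p) < (p - 2) * (m - 1) + (m - (p - 2)) * (p - 2)"
proof -
  define q where "q = m div p"
  have mq: "m = p * q + k" using k q_def by simp
  have k0: "0 \<le> k" "k < p" using k p by auto
  \<comment> \<open>This expression is the right side minus the left side of the goal.\<close>
  have "0 < m * (p - 3) - (p - 1) * (p - 2) + k * (p - k)"
  proof (cases "q \<ge> 2")
    case True
    have "p * 2 \<le> p * q" using True p by (intro mult_left_mono) auto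
    then have "2 * p \<le> m" using mq k0 by linarith
    then have "2 * p * (p - 3) \<le> m * (p - 3)" using p by (intro mult_right_mono) auto
    moreover have "0 \<le> k * (p - k)" using k0 by simp
    moreover have "4 * (p - 3) \<le> p * (p - 3)" using p by (intro mult_right_mono) auto
    ultimately show ?thesis using p by (simp add: algebra_simps)
  next
    case False
    have "q > 0"
    proof (rule ccontr)
      assume "\<not> q > 0"
      then have "p * q \<le> 0" using p by (simp add: mult_le_0_iff)
      then show False using mq k0 m by linarith
    qed
    with False have "q = 1" by simp
    then have mk: "m = p + k" "k \<ge> 1" using mq m by auto
    \<comment> \<open>For \<open>m = p + k\<close> the difference simplifies to
      \<open>k * (2 * p - 3 - k) - 2\<close>.\<close>
    have "k * (2 * p - 3 - k) > 2"
    proof (cases "k = 1")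
      case False
      then have "2 * 2 \<le> k * (2 * p - 3 - k)" using mk k0 p by (intro mult_mono) auto
      then show ?thesis by simp
    qed (use p in simp)
    then show ?thesis using mk by (simp add: algebra_simps)
  qed
  then show ?thesis by (simp add: algebra_simps)
qed

text \<open>A degree-sum argument for the vertices outside the \<open>p\<close>-cliques. Common
  neighbours of nonadjacent vertices force every degree to be at least \<open>p - 2\<close>; the
  cases are whether this value is attained. Strictness is what later excludes further extremal
  graphs.\<close>

lemma clique_completing_edges_bound:
  fixes B :: "'a set"
  assumes fin: "finite B" and E: "E \<subseteq> pairs B" and p: "p \<ge> 4" and m: "card B \<ge> p + 1"
    and sat: "\<And>u v. u \<in> B \<Longrightarrow> v \<in> B \<Longrightarrow> u \<noteq> v \<Longrightarrow> {u, v} \<notin> E \<Longrightarrow>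
      \<exists>T \<subseteq> B. u \<in> T \<and> v \<in> T \<and> card T = p \<and> pairs T \<subseteq> insert {u, v} E"
  shows "(int p - 1) * int (card B) + int (card B mod p) * (int (card B mod p) - int p) < 2 * int (card E)"
proof -
  define N where "N v = {w. {v, w} \<in> E}" for v
  define m where "m = card B"
  have N_B: "N v \<subseteq> B - {v}" for v using E doubleton_in_pairs[of v _ B] by (auto simp: N_def)
  have N_sym: "x \<in> N y \<longleftrightarrow> y \<in> N x" for x y by (simp add: N_def insert_commute)
  have finN: "finite (N v)" for v using fin by (intro finite_subset[OF N_B]) simp
  have sum: "(\<Sum>v\<in>B. card (N v)) = 2 * card E" unfolding N_def by (rule sum_degrees[OF fin E])
  \<comment> \<open>Take the \<open>p\<close>-clique completed by the edge \<open>{u, v}\<close> and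
    remove its two ends.\<close>
  have common: "\<exists>C. C \<subseteq> N u \<inter> N v \<and> card C = p - 2 \<and> pairs C \<subseteq> E"
    if uv: "u \<in> B" "v \<in> B" "u \<noteq> v" "v \<notin> N u" for u v
  proof -
    obtain T where T: "T \<subseteq> B" "u \<in> T" "v \<in> T" "card T = p" "pairs T \<subseteq> insert {u, v} E"
      using sat[OF uv(1-3)] uv(4) by (auto simp: N_def)
    have TE: "{x, y} \<in> E" if "x \<in> T" "y \<in> T" "x \<noteq> y" "{x, y} \<noteq> {u, v}" for x y
      using T(5) that by (auto simp: pairs_subset_iff)
    have "card (T - {u, v}) = p - 2"
      using T that by (simp add: card_Diff_subset)
    moreover have "T - {u, v} \<subseteq> N u \<inter> N v"
      using T(2,3) TE[of u] TE[of v] by (auto simp: N_def doubleton_eq_iff)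
    moreover have "pairs (T - {u, v}) \<subseteq> E"
      using TE by (auto simp: pairs_subset_iff doubleton_eq_iff)
    ultimately show ?thesis by blast
  qed
  have full: "card (N v) = m - 1" if "v \<in> B" "\<And>u. u \<in> B \<Longrightarrow> u \<noteq> v \<Longrightarrow> u \<in> N v" for v
  proof -
    have "N v = B - {v}" using N_B that by blast
    then show ?thesis using fin that(1) by (simp add: m_def)
  qed
  have deg_ge: "p - 2 \<le> card (N v)" if v: "v \<in> B" for v
  proof (cases "\<forall>u\<in>B. u \<noteq> v \<longrightarrow> u \<in> N v")
    case True
    then show ?thesis using full[of v] v m by (simp add: m_def)
  next
    case False
    then obtain u where "u \<in> B" "u \<noteq> v" "u \<notin> N v" by blast
    then obtain C where "C \<subseteq> N v" "card C = p - 2" using common[of v u] v by blast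
    then show ?thesis using card_mono[OF finN[of v], of C] by simp
  qed
  show ?thesis
  proof (cases "\<exists>v\<in>B. card (N v) = p - 2")
    case True
    then obtain v where v: "v \<in> B" "card (N v) = p - 2" by blast
    \<comment> \<open>Degree \<open>p - 2\<close> leaves no choice: the clique of common neighbours
      of \<open>v\<close> and \<open>u\<close> is all of \<open>N v\<close>.\<close>
    have C: "N v \<subseteq> N u \<and> pairs (N v) \<subseteq> E" if u: "u \<in> B" "u \<noteq> v" "u \<notin> N v" for u
    proof -
      obtain C where C: "C \<subseteq> N v \<inter> N u" "card C = p - 2" "pairs C \<subseteq> E"
        using common[of v u] u v by blast
      then have "C = N v" using v finN by (intro card_subset_eq) auto
      then show ?thesis using C by blast
    qed
    \<comment> \<open>A nonneighbour of \<open>v\<close> must exist before the previous fact can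
      show that \<open>N v\<close> is a clique.\<close>
    have "\<not> B \<subseteq> insert v (N v)"
    proof
      assume "B \<subseteq> insert v (N v)"
      then have "card B \<le> card (insert v (N v))" using finN by (intro card_mono) auto
      also have "\<dots> \<le> Suc (p - 2)" using v card_insert_le_m1[of "Suc (p - 2)" "N v" v] by simp
      finally show False using m p by simp
    qed
    then have clique: "pairs (N v) \<subseteq> E" using C by blast
    \<comment> \<open>Each \<open>x\<close> in \<open>N v\<close> is adjacent to \<open>v\<close>,
      to the rest of the clique \<open>N v\<close>, and to every nonneighbour of
      \<open>v\<close>.\<close>
    have "card (N x) = m - 1" if x: "x \<in> N v" for x
    proof (rule full)
      fix y assume y: "y \<in> B" "y \<noteq> x"
      show "y \<in> N x"
      proof (cases "y \<in> insert v (N v)")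
        case True
        then show ?thesis using x y clique N_sym[of v x] by (auto simp: N_def pairs_subset_iff)
      next
        case False
        then show ?thesis using C[of y] x y N_sym[of x y] by auto
      qed
    qed (use N_B x in auto)
    then have "(\<Sum>x\<in>N v. card (N x)) = (p - 2) * (m - 1)" using v by simp
    moreover have "(m - (p - 2)) * (p - 2) \<le> (\<Sum>x\<in>B - N v. card (N x))"
    proof -
      have "card (B - N v) = m - (p - 2)" using N_B finN v by (subst card_Diff_subset) (auto simp: m_def)
      then show ?thesis using sum_bounded_below[of "B - N v" "p - 2" "\<lambda>x. card (N x)"] deg_ge by simp
    qed
    moreover have "(\<Sum>x\<in>B. card (N x)) = (\<Sum>x\<in>B - N v. card (N x)) + (\<Sum>x\<in>N v. card (N x))"
      using N_B fin by (intro sum.subset_diff) auto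
    ultimately have "(p - 2) * (m - 1) + (m - (p - 2)) * (p - 2) \<le> 2 * card E" using sum by simp
    then have "int ((p - 2) * (m - 1) + (m - (p - 2)) * (p - 2)) \<le> 2 * int (card E)"
      by linarith
    moreover have "int ((p - 2) * (m - 1) + (m - (p - 2)) * (p - 2))
        = (int p - 2) * (int m - 1) + (int m - (int p - 2)) * (int p - 2)"
      using m p by (simp add: of_nat_diff m_def)
    moreover have "(int p - 1) * int m + int (m mod p) * (int (m mod p) - int p)
        < (int p - 2) * (int m - 1) + (int m - (int p - 2)) * (int p - 2)"
      using m p by (intro degree_sum_arith) (auto simp: m_def zmod_int)
    ultimately show ?thesis unfolding m_def by linarith
  next
    case False
    then have deg: "p - 1 \<le> card (N v)" if "v \<in> B" for v
    proof -
      have "card (N v) \<noteq> p - 2" using False that by blast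
      then show ?thesis using deg_ge[OF that] by linarith
    qed
    have le: "m * (p - 1) \<le> 2 * card E"
      using sum_bounded_below[of B "p - 1" "\<lambda>x. card (N x)"] deg sum by (simp add: m_def)
    then have le': "int m * (int p - 1) \<le> 2 * int (card E)"
    proof -
      have "int (m * (p - 1)) \<le> 2 * int (card E)" using le by linarith
      then show ?thesis using p by (simp add: of_nat_diff)
    qed
    \<comment> \<open>If \<open>p\<close> does not divide \<open>m\<close>, the correction
      \<open>k * (k - p)\<close> with \<open>k = m mod p\<close> is negative and the degree bound is
      already strict. If it does, the correction vanishes and equality would make the graph
      \<open>(p - 1)\<close>-regular.\<close>
    show ?thesis
    proof (cases "m mod p = 0")
      case False
      then have "int (m mod p) * (int (m mod p) - int p) < 0"
        using p by (intro mult_pos_neg) auto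
      then show ?thesis using le' unfolding m_def by (simp add: mult.commute)
    next
      case k0: True
      have "m * (p - 1) \<noteq> 2 * card E"
      proof
        assume eq: "m * (p - 1) = 2 * card E"
        have reg: "card (N v) = p - 1" if "v \<in> B" for v
        proof (rule ccontr)
          assume "card (N v) \<noteq> p - 1"
          then have "(\<Sum>x\<in>B. p - 1) < (\<Sum>x\<in>B. card (N x))"
            using deg that fin by (intro sum_strict_mono_ex1) (auto intro!: bexI[of _ v] simp: le_neq_implies_less)
          then show False using eq sum by (simp add: m_def)
        qed
        have "B \<noteq> {}" using m by auto
        then obtain v where v: "v \<in> B" by blast
        let ?U = "B - insert v (N v)"
        \<comment> \<open>A multiple of \<open>p\<close> above \<open>p\<close> is at least
          \<open>2 * p\<close>; as \<open>v\<close> has \<open>p - 1\<close> neighbours, at least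
          \<open>p\<close> nonneighbours remain in \<open>?U\<close>.\<close>
        have "2 * p \<le> m"
        proof -
          obtain q where q: "m = p * q" using k0 by (auto simp: mod_eq_0_iff_dvd)
          have "q \<noteq> 0" using q m by (intro notI) (simp add: m_def)
          moreover have "q \<noteq> 1" using q m by (auto simp: m_def)
          ultimately have "2 \<le> q" by simp
          then show ?thesis using q by simp
        qed
        moreover have "card ?U = m - p"
          using N_B finN v p reg[OF v] by (subst card_Diff_subset) (auto simp: m_def card_insert_if)
        ultimately have U: "p \<le> card ?U" by simp
        \<comment> \<open>Edges between \<open>?U\<close> and \<open>N v\<close> are counted twice.
          Each \<open>u\<close> in \<open>?U\<close> sends at least \<open>p - 2\<close> of them;
          each \<open>x\<close> in \<open>N v\<close> receives at most \<open>p - 2\<close>, since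
          one of its \<open>p - 1\<close> neighbours is \<open>v\<close>.\<close>
        have "card ?U * (p - 2) \<le> (\<Sum>u\<in>?U. card {x \<in> N v. x \<in> N u})"
        proof -
          have "p - 2 \<le> card {x \<in> N v. x \<in> N u}" if u: "u \<in> ?U" for u
          proof -
            obtain C where "C \<subseteq> N v \<inter> N u" "card C = p - 2" using common[of v u] u v by blast
            moreover from this have "card C \<le> card {x \<in> N v. x \<in> N u}"
              using finN by (intro card_mono) auto
            ultimately show ?thesis by simp
          qed
          then show ?thesis using sum_bounded_below[of ?U "p - 2"] by simp
        qed
        also have "\<dots> = (\<Sum>x\<in>N v. card {u \<in> ?U. x \<in> N u})"
          using fin finN by (intro sum_multicount_gen) auto
        also have "\<dots> \<le> (\<Sum>x\<in>N v. p - 2)"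
        proof (rule sum_mono)
          fix x assume x: "x \<in> N v"
          then have "x \<in> B" using N_B by blast
          have "{u \<in> ?U. x \<in> N u} \<subseteq> N x - {v}" using N_sym by auto
          then have "card {u \<in> ?U. x \<in> N u} \<le> card (N x - {v})" using finN by (intro card_mono) auto
          also have "\<dots> = p - 2" using x N_sym[of x v] reg[OF \<open>x \<in> B\<close>] finN by (simp add: card_Diff_singleton)
          finally show "card {u \<in> ?U. x \<in> N u} \<le> p - 2" .
        qed
        also have "\<dots> = (p - 1) * (p - 2)" using reg[OF v] by simp
        finally have "card ?U * (p - 2) \<le> (p - 1) * (p - 2)" .
        then show False using U p by simp
      qed
      then have "m * (p - 1) < 2 * card E" using le by simp
      then have "int (m * (p - 1)) < 2 * int (card E)" by linarith
      then show ?thesis using k0 p by (simp add: m_def of_nat_diff mult.commute)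
    qed
  qed
qed

subsection \<open>The extremal graphs\<close>

text \<open>Doubled and over the integers, so that the edge counts need neither division nor
  truncated subtraction.\<close>

lemma two_choose_two: "2 * int (m choose 2) = int m * (int m - 1)"
  by (induction m) (auto simp: numeral_2_eq_2 algebra_simps)

text \<open>The \<open>p\<close>-cliques are disjoint components, and \<open>B\<close> carries the
  remaining edges. If \<open>B\<close> is complete, \<open>G\<close> is a union of cliques;
  otherwise the strict bound on \<open>B\<close> adds to the exact count for the cliques. This
  dichotomy yields both the value and the uniqueness.\<close>

lemma saturated_cases:
  fixes G :: "'a graph"
  assumes G: "simple_graph G" "\<not> pendant_clique p G"
    and sat: "\<And>e. e \<in> pairs (verts G) - edges G \<Longrightarrow> pendant_clique p (add_edge G e)"
    and p: "p \<ge> 4"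
  defines "n \<equiv> card (verts G)"
  shows "(\<exists>P B. G = clique_union P B \<and> clique_blocks p P B) \<or>
    (int p - 1) * int n + int (n mod p) * (int (n mod p) - int p) < 2 * int (card (edges G))"
proof -
  define P where "P = {T. T \<subseteq> verts G \<and> card T = p \<and> pairs T \<subseteq> edges G}"
  define B where "B = verts G - \<Union>P"
  have finV: "finite (verts G)" and E: "edges G \<subseteq> pairs (verts G)"
    using G by (auto simp: simple_graph_def)
  have finP: "finite P" using finV by (auto simp: P_def)
  have blocks: "finite T \<and> card T = p" if "T \<in> P" for T
    using that finV finite_subset by (auto simp: P_def)
  \<comment> \<open>An edge leaving a member of \<open>P\<close> would be a pendant edge.\<close>
  have closed: "w \<in> T" if "T \<in> P" "v \<in> T" "{v, w} \<in> edges G" for T v w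
    using pendant_cliqueI[of T G p v w] G(2) that by (auto simp: P_def)
  have clique: "{v, w} \<in> edges G" if "T \<in> P" "v \<in> T" "w \<in> T" "v \<noteq> w" for T v w
    using that by (auto simp: P_def pairs_subset_iff)
  have disj: "pairwise disjnt P"
  proof (rule pairwiseI)
    fix S T assume ST: "S \<in> P" "T \<in> P" "S \<noteq> T"
    have "S' \<subseteq> T'" if *: "S' \<in> P" "T' \<in> P" "x \<in> S'" "x \<in> T'" for S' T' x
    proof
      fix y assume y: "y \<in> S'"
      show "y \<in> T'"
      proof (cases "y = x")
        case False
        then have "{x, y} \<in> edges G" using clique[OF *(1,3) y] by simp
        then show ?thesis using closed[OF *(2,4)] by simp
      qed (use * in simp)
    qed
    \<comment> \<open>Cliques sharing a vertex contain each other, so distinct members of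
      \<open>P\<close> share none.\<close>
    then show "disjnt S T" using ST unfolding disjnt_def by blast
  qed
  have PB: "\<Union>P \<inter> B = {}" "\<Union>P \<union> B = verts G" by (auto simp: B_def P_def)
  have finB: "finite B" using finV by (simp add: B_def)
  have edges: "edges G = (\<Union>T\<in>P. pairs T) \<union> edges G \<inter> pairs B"
  proof (intro equalityI subsetI)
    fix e assume e: "e \<in> edges G"
    then have "e \<in> pairs (verts G)" using E by blast
    then obtain x y where xy: "e = {x, y}" "x \<noteq> y" "x \<in> verts G" "y \<in> verts G" by (rule in_pairsE)
    show "e \<in> (\<Union>T\<in>P. pairs T) \<union> edges G \<inter> pairs B"
    proof (cases "\<exists>T\<in>P. x \<in> T \<or> y \<in> T")
      case True
      then obtain T where T: "T \<in> P" "x \<in> T \<or> y \<in> T" by blast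
      have "x \<in> T \<and> y \<in> T"
        using T closed[OF T(1), of x y] closed[OF T(1), of y x] e xy by (auto simp: insert_commute)
      then show ?thesis using T xy by (auto simp: doubleton_in_pairs)
    next
      case False
      then show ?thesis using e xy by (auto simp: B_def doubleton_in_pairs)
    qed
  qed (auto simp: P_def)
  have n: "n = card P * p + card B"
    using card_Union_blocks[OF finP blocks disj finB PB(1)] PB(2) by (simp add: n_def)
  have card_E: "card (edges G) = card P * (p choose 2) + card (edges G \<inter> pairs B)"
    using card_edges_clique_union[OF finP blocks disj, of "edges G \<inter> pairs B" B] PB(1) finB
    by (subst edges) (auto simp: finite_pairs)
  show ?thesis
  proof (cases "pairs B \<subseteq> edges G")
    case True
    \<comment> \<open>Any \<open>p\<close> vertices of a complete \<open>B\<close> would form a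
      member of \<open>P\<close>, contrary to the choice of \<open>B\<close>.\<close>
    have "card B < p"
    proof (rule ccontr)
      assume "\<not> card B < p"
      then obtain T where T: "T \<subseteq> B" "card T = p" using obtain_subset_with_card_n[of p B] by auto
      then have "pairs T \<subseteq> edges G" using True pairs_mono by blast
      then have "T \<in> P" using T by (auto simp: P_def B_def)
      then show False using T PB(1) p by (cases "T = {}") auto
    qed
    moreover have "edges G = edges (clique_union P B)"
      using edges True by (simp add: clique_union_def Int_absorb1)
    then have "G = clique_union P B"
      using PB by (intro graph.expand) (simp add: clique_union_def)
    ultimately show ?thesis using finP blocks disj finB PB by (auto simp: clique_blocks_def)
  next
    case False
    \<comment> \<open>The new \<open>p\<close>-clique is shown to lie inside \<open>B\<close>. The
      bound on \<open>card B\<close> is proved along with it, because it comes from the pendant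
      vertex of the same clique.\<close>
    have missing: "\<exists>T \<subseteq> B. (u \<in> T \<and> v \<in> T \<and> card T = p \<and> pairs T \<subseteq> insert {u, v} (edges G \<inter> pairs B))
        \<and> p + 1 \<le> card B"
      if uv: "u \<in> B" "v \<in> B" "u \<noteq> v" "{u, v} \<notin> edges G" for u v
    proof -
      have "{u, v} \<in> pairs (verts G) - edges G" using uv by (simp add: doubleton_in_pairs B_def)
      then obtain T x w where T: "T \<subseteq> verts G" "card T = p" "pairs T \<subseteq> insert {u, v} (edges G)"
        "x \<in> T" "w \<notin> T" "{x, w} \<in> insert {u, v} (edges G)"
        using sat[of "{u, v}"] unfolding pendant_clique_def add_edge_def by auto
      have TE: "{a, b} \<in> edges G" if "a \<in> T" "b \<in> T" "a \<noteq> b" "{a, b} \<noteq> {u, v}" for a b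
        using T(3) that by (auto simp: pairs_subset_iff)
      \<comment> \<open>Otherwise \<open>T\<close> is an old \<open>p\<close>-clique, so the edge
        leaving it must be the new one; but then \<open>u\<close> or \<open>v\<close> lies in
        \<open>T\<close>, although both are in \<open>B\<close>.\<close>
      have "{u, v} \<subseteq> T"
      proof (rule ccontr)
        assume "\<not> {u, v} \<subseteq> T"
        then have "pairs T \<subseteq> edges G" using T(3) by (auto simp: pairs_def)
        then have "T \<in> P" using T by (simp add: P_def)
        then have "{x, w} = {u, v}" using T closed by blast
        then show False using \<open>T \<in> P\<close> T(4) uv PB(1) by (auto simp: doubleton_eq_iff)
      qed
      then have u: "u \<in> T" and v: "v \<in> T" by auto
      have TB: "T \<subseteq> B"
      proof
        fix t assume t: "t \<in> T"
        show "t \<in> B"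
        proof (rule ccontr)
          assume tB: "t \<notin> B"
          then obtain S where S: "S \<in> P" "t \<in> S" using t T(1) by (auto simp: B_def)
          \<comment> \<open>A vertex \<open>t\<close> of \<open>T\<close> in an old
            \<open>p\<close>-clique \<open>S\<close> would be joined to \<open>u\<close> by an old
            edge and pull \<open>u\<close> into \<open>S\<close>.\<close>
          have "{t, u} \<in> edges G" using t u tB uv by (intro TE) (auto simp: doubleton_eq_iff)
          then have "u \<in> S" using closed[OF S] by simp
          then show False using S uv by (auto simp: B_def)
        qed
      qed
      \<comment> \<open>The new edge lies within \<open>T\<close>, so the pendant edge is an old
        one. Starting in \<open>B\<close> it cannot enter a member of \<open>P\<close>, hence
        \<open>w\<close> is a further vertex of \<open>B\<close>.\<close>
      have "{x, w} \<in> edges G" using T u v by auto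
      moreover have "x \<in> B" using T TB by auto
      ultimately have "w \<in> B" using E closed[of _ w x] by (auto simp: B_def doubleton_in_pairs insert_commute)
      then have "card (insert w T) \<le> card B" using TB finB by (intro card_mono) auto
      moreover have "finite T" using TB finB finite_subset by blast
      ultimately have "p + 1 \<le> card B" using T by simp
      moreover have "pairs T \<subseteq> insert {u, v} (edges G \<inter> pairs B)" using T(3) pairs_mono[OF TB] by blast
      ultimately show ?thesis using TB u v T(2) by blast
    qed
    obtain u v where "u \<in> B" "v \<in> B" "u \<noteq> v" "{u, v} \<notin> edges G"
      using False by (auto simp: pairs_subset_iff)
    then have "p + 1 \<le> card B" using missing by blast
    then have "(int p - 1) * int (card B) + int (card B mod p) * (int (card B mod p) - int p)
        < 2 * int (card (edges G \<inter> pairs B))"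
      using missing by (intro clique_completing_edges_bound[OF finB _ p]) (auto simp: doubleton_in_pairs)
    \<comment> \<open>\<open>n\<close> and \<open>card B\<close> differ by a multiple of
      \<open>p\<close>, so they have the same residue.\<close>
    then have "(int p - 1) * int (card B) + int (n mod p) * (int (n mod p) - int p)
        < 2 * int (card (edges G \<inter> pairs B))" using n by simp
    moreover have "2 * int (card (edges G)) = int (card P) * (int p * (int p - 1)) + 2 * int (card (edges G \<inter> pairs B))"
      unfolding card_E two_choose_two[symmetric] by simp
    moreover have "(int p - 1) * int n = int (card P) * (int p * (int p - 1)) + (int p - 1) * int (card B)"
      using n by (simp add: algebra_simps)
    ultimately have "(int p - 1) * int n + int (n mod p) * (int (n mod p) - int p) < 2 * int (card (edges G))"
      by linarith
    then show ?thesis ..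
  qed
qed

section \<open>Isomorphism classes and existence of the extremal graph\<close>

text \<open>Simplicity of \<open>G\<close> places every edge inside \<open>verts G\<close>, where
  the inverse bijection undoes \<open>f\<close>.\<close>

lemma graph_iso_sym:
  assumes "simple_graph G" "graph_iso G H"
  shows "graph_iso H G"
proof -
  obtain f where f: "bij_betw f (verts G) (verts H)" "edges H = (`) f ` edges G"
    using assms by (auto simp: graph_iso_def)
  let ?g = "inv_into (verts G) f"
  have "?g ` f ` e = e" if "e \<in> edges G" for e
    using that assms(1) f(1) by (intro inv_into_image_cancel) (auto simp: simple_graph_def pairs_def bij_betw_def)
  then have "(`) ?g ` edges H = edges G" using f(2) by (simp add: image_image)
  then show ?thesis using bij_betw_inv_into[OF f(1)] unfolding graph_iso_def by (intro exI[of _ ?g]) simp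
qed

lemma graph_iso_trans:
  assumes "graph_iso G H" "graph_iso H K"
  shows "graph_iso G K"
proof -
  obtain f g where f: "bij_betw f (verts G) (verts H)" "edges H = (`) f ` edges G"
    and g: "bij_betw g (verts H) (verts K)" "edges K = (`) g ` edges H"
    using assms by (auto simp: graph_iso_def)
  have "edges K = (`) (g \<circ> f) ` edges G" by (simp add: f(2) g(2) image_image)
  then show ?thesis using bij_betw_trans[OF f(1) g(1)] unfolding graph_iso_def by blast
qed

lemma iso_class_eqI:
  assumes "simple_graph G" "graph_iso G H"
  shows "iso_class H = iso_class G"
  unfolding iso_class_def
  using graph_iso_trans[OF assms(2)] graph_iso_trans[OF graph_iso_sym[OF assms]] by auto

text \<open>Cut an initial segment of the naturals into \<open>q\<close> consecutive intervals of
  length \<open>p\<close>, followed by one of length \<open>k\<close>. This realises the extremal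
  graph on natural numbers.\<close>

lemma exists_clique_blocks:
  assumes "k < p"
  shows "\<exists>P (B :: nat set). clique_blocks p P B \<and> card P = q \<and> card B = k"
proof (intro exI conjI)
  let ?T = "\<lambda>i. {i * p..<i * p + p}"
  have sep: "i * p + p \<le> j * p" if "i < j" for i j
    using mult_le_mono1[of "Suc i" j p] that by simp
  have disj: "?T i \<inter> ?T j = {}" if "i \<noteq> j" for i j
  proof (cases "i < j")
    case True
    then show ?thesis using sep[of i j] by (simp add: ivl_disj_int)
  next
    case False
    then show ?thesis using sep[of j i] that by (simp add: ivl_disj_int)
  qed
  have "inj_on ?T {..<q}"
  proof (intro inj_onI, rule ccontr)
    fix i j assume "?T i = ?T j" "i \<noteq> j"
    then have "?T i = {}" using disj[of i j] by blast
    then show False using assms by simp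
  qed
  then show "card (?T ` {..<q}) = q" by (simp add: card_image)
  show "card {q * p..<q * p + k} = k" by simp
  have "?T i \<inter> {q * p..<q * p + k} = {}" if "i < q" for i
    using sep[OF that] by auto
  then have "\<Union>(?T ` {..<q}) \<inter> {q * p..<q * p + k} = {}" by blast
  moreover have "pairwise disjnt (?T ` {..<q})"
    unfolding pairwise_image by (intro pairwiseI) (use disj in \<open>auto simp only: disjnt_def\<close>)
  ultimately show "clique_blocks p (?T ` {..<q}) {q * p..<q * p + k}"
    using assms by (simp add: clique_blocks_def)
qed

theorem theorem1p2:
  fixes p k n :: nat
  assumes "p \<ge> 4" and "0 \<le> k" and "k \<le> p - 1" and "n \<ge> p + 1" and "[n = k] (mod p)"
  shows "real (sat n (join (complete_graph 1) (disj_union (complete_graph (p - 1)) (complete_graph 1))))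
           = (real p - 1) * real n / 2 + real k * (real k - real p) / 2
       \<and> SAT n (join (complete_graph 1) (disj_union (complete_graph (p - 1)) (complete_graph 1)))
           = {iso_class (disj_union (copies (n div p) (complete_graph p)) (complete_graph k))}"
proof -
  define F where "F = join (complete_graph 1) (disj_union (complete_graph (p - 1)) (complete_graph 1))"
  define q where "q = n div p"
  \<comment> \<open>The number of edges of the claimed extremal graph.\<close>
  define M where "M = q * (p choose 2) + (k choose 2)"
  define G0 where "G0 = disj_union (copies q (complete_graph p)) (complete_graph k)"
  have k: "k = n mod p" "k < p" using assms by (auto simp: cong_def)
  have n: "n = q * p + k" by (simp add: q_def k)
  have saturated_iff: "saturated F G \<longleftrightarrow> simple_graph G \<and> \<not> pendant_clique p G \<and>
       (\<forall>e \<in> pairs (verts G) - edges G. pendant_clique p (add_edge G e))" for G :: "nat graph"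
    unfolding F_def using assms by (intro saturated_pendant_iff) simp
  have M: "2 * int M = (int p - 1) * int n + int k * (int k - int p)"
  proof -
    have "2 * int M = int q * (2 * int (p choose 2)) + 2 * int (k choose 2)" by (simp add: M_def)
    then show ?thesis unfolding two_choose_two by (simp add: n algebra_simps)
  qed
  have clique_union: "clique_union P B \<in> saturated_graphs n F \<and> card (edges (clique_union P B)) = M"
    if "clique_blocks p P B" "card P = q" "card B = k" for P :: "nat set set" and B
  proof
    have *: "finite P" "\<And>T. T \<in> P \<Longrightarrow> finite T \<and> card T = p" "pairwise disjnt P"
      "finite B" "\<Union>P \<inter> B = {}" using that by (auto simp: clique_blocks_def)
    have "P \<noteq> {}" using that(2) n k assms by auto
    then show "clique_union P B \<in> saturated_graphs n F"
      using clique_union_saturated[OF that(1)] card_Union_blocks[OF *] that n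
      by (simp add: saturated_graphs_def saturated_iff clique_union_def)
    show "card (edges (clique_union P B)) = M"
      using card_edges_clique_union[OF *(1-3), of "pairs B" B] * that
      by (simp add: clique_union_def M_def finite_pairs card_pairs)
  qed
  have cases: "(\<exists>P B. G = clique_union P B \<and> clique_blocks p P B \<and> card P = q \<and> card B = k)
      \<or> M < card (edges G)" if G: "G \<in> saturated_graphs n F" for G
  proof -
    have sat: "simple_graph G" "\<not> pendant_clique p G" "card (verts G) = n"
      "\<And>e. e \<in> pairs (verts G) - edges G \<Longrightarrow> pendant_clique p (add_edge G e)"
      using G by (auto simp: saturated_graphs_def saturated_iff)
    \<comment> \<open>Since \<open>card B < p\<close>, the sizes are the quotient and remainder of
      \<open>n\<close> by \<open>p\<close>.\<close>
    have "card P = q \<and> card B = k" if "G = clique_union P B" "clique_blocks p P B" for P B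
    proof -
      have "n = card P * p + card B" "card B < p"
        using sat(3) that card_Union_blocks[of P p B] by (auto simp: clique_blocks_def clique_union_def)
      then show ?thesis using assms by (simp add: q_def k)
    qed
    then show ?thesis
      using saturated_cases[OF sat(1,2,4) assms(1)] sat(3) M k(1) by auto
  qed
  obtain P1 :: "nat set set" and B1 where PB1: "clique_blocks p P1 B1" "card P1 = q" "card B1 = k"
    using exists_clique_blocks[OF k(2)] by blast
  have sat: "sat n F = M"
    unfolding sat_def
  proof (rule Least_equality)
    show "\<exists>G\<in>saturated_graphs n F. card (edges G) = M" using clique_union[OF PB1] by blast
    fix m assume "\<exists>G\<in>saturated_graphs n F. card (edges G) = m"
    \<comment> \<open>A saturated graph either is a clique union with exactly \<open>M\<close> edges
      or has more than \<open>M\<close>.\<close>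
    then show "M \<le> m" using cases clique_union by fastforce
  qed
  have simple: "simple_graph G0"
    unfolding G0_def by (intro simple_graph_disj_union simple_graph_copies simple_graph_complete_graph)
  have iso: "iso_class (clique_union P B) = iso_class G0"
    if "clique_blocks p P B" "card P = q" "card B = k" for P :: "nat set set" and B
    using clique_union_iso[OF that(1)] that simple by (intro iso_class_eqI) (simp_all add: G0_def)
  have "SAT n F = {iso_class G0}"
  proof (intro equalityI subsetI)
    fix c assume "c \<in> SAT n F"
    then obtain G where "G \<in> saturated_graphs n F" "card (edges G) = M" "c = iso_class G"
      by (auto simp: SAT_def sat)
    then show "c \<in> {iso_class G0}" using cases[of G] iso by auto
  next
    fix c assume "c \<in> {iso_class G0}"
    then have "c = iso_class (clique_union P1 B1)" using iso[OF PB1] by simp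
    then show "c \<in> SAT n F" using clique_union[OF PB1] by (auto simp: SAT_def sat)
  qed
  moreover have "real (sat n F) = (real p - 1) * real n / 2 + real k * (real k - real p) / 2"
  proof -
    have "2 * real M = (real p - 1) * real n + real k * (real k - real p)"
      using arg_cong[OF M, of real_of_int] by simp
    then show ?thesis by (simp add: sat field_simps)
  qed
  ultimately show ?thesis by (simp add: F_def G0_def q_def)
qed

end
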